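(* Let $X$ and $Y$ be real Banach spaces, let $x\in B_X$, $y\in B_Y$, and let $N$ be an absolute normalised norm on $\mathbb{R}^2$ different from the $\ell_\infty$-norm. Assume that $(x,y)$ is a Daugavet-point in $X\oplus_N Y$. (a) If $x\neq 0$, then $x/\|x\|$ is a Daugavet-point in $X$. (b) If $y\neq 0$, then $y/\|y\|$ is a Daugavet-point in $Y$.
   Context: All Banach spaces are real. $B_X$ and $S_X$ denote the closed unit ball and unit sphere of $X$. For $x\in S_X$ and $\varepsilon>0$ put $\Delta_\varepsilon(x)=\{y\in B_X : \|x-y\|\ge 2-\varepsilon\}$. A point $x\in S_X$ is a Daugavet-point of $X$ if $B_X\subset\overline{\mathrm{conv}}\,\Delta_\varepsilon(x)$ for every $\varepsilon>0$ (in particular a Daugavet-point has norm one). A norm $N$ on $\mathbb{R}^2$ is absolute if $N(a,b)=N(|a|,|b|)$ for all $(a,b)\in\mathbb{R}^2$, and normalised if $N(1,0)=N(0,1)=1$. For such $N$, $X\oplus_N Y$ is the direct sum $X\oplus Y$ with norm $\|(x,y)\|_N=N(\|x\|,\|y\|)$. *)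

theory Defs
  imports "HOL-Analysis.Analysis"
begin

definition is_norm :: "('v::real_vector \<Rightarrow> real) \<Rightarrow> bool" where
  "is_norm p \<longleftrightarrow> (\<forall>v. p v = 0 \<longrightarrow> v = 0) \<and> (\<forall>c v. p (c *\<^sub>R v) = \<bar>c\<bar> * p v) \<and>
     (\<forall>v w. p (v + w) \<le> p v + p w)"

definition absolute_norm :: "(real \<times> real \<Rightarrow> real) \<Rightarrow> bool" where
  "absolute_norm N \<longleftrightarrow> is_norm N \<and> (\<forall>a b. N (a, b) = N (\<bar>a\<bar>, \<bar>b\<bar>))"

definition normalised :: "(real \<times> real \<Rightarrow> real) \<Rightarrow> bool" where
  "normalised N \<longleftrightarrow> N (1, 0) = 1 \<and> N (0, 1) = 1"

definition linf_norm :: "real \<times> real \<Rightarrow> real" where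
  "linf_norm = (\<lambda>(a, b). max \<bar>a\<bar> \<bar>b\<bar>)"

text \<open>
  The type \<open>'a \<times> 'b\<close> already carries the Euclidean product norm. So that \<open>X \<oplus>\<^sub>N Y\<close> can share
  this carrier, the notions below take the norm \<open>p\<close> of the space as an explicit argument.
\<close>

definition sum_norm ::
  "(real \<times> real \<Rightarrow> real) \<Rightarrow> 'a::real_normed_vector \<times> 'b::real_normed_vector \<Rightarrow> real" where
  "sum_norm N = (\<lambda>(x, y). N (norm x, norm y))"

definition unit_ball :: "('v::real_vector \<Rightarrow> real) \<Rightarrow> 'v set" where
  "unit_ball p = {v. p v \<le> 1}"

definition norm_topology :: "('v::real_vector \<Rightarrow> real) \<Rightarrow> 'v topology" where
  "norm_topology p = Metric_space.mtopology UNIV (\<lambda>v w. p (v - w))"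

definition Delta :: "('v::real_vector \<Rightarrow> real) \<Rightarrow> real \<Rightarrow> 'v \<Rightarrow> 'v set" where
  "Delta p \<epsilon> x = {y \<in> unit_ball p. p (x - y) \<ge> 2 - \<epsilon>}"

definition daugavet_point :: "('v::real_vector \<Rightarrow> real) \<Rightarrow> 'v \<Rightarrow> bool" where
  "daugavet_point p x \<longleftrightarrow> p x = 1 \<and>
     (\<forall>\<epsilon>>0. unit_ball p \<subseteq> norm_topology p closure_of (convex hull (Delta p \<epsilon> x)))"

lemma Metric_space_is_norm:
  assumes "is_norm p"
  shows "Metric_space UNIV (\<lambda>v w. p (v - w))"
proof -
  have h: "p (c *\<^sub>R v) = \<bar>c\<bar> * p v" and t: "p (v + w) \<le> p v + p w" and z: "p v = 0 \<Longrightarrow> v = 0"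
    for c v w using assms by (auto simp: is_norm_def)
  have m: "p (- v) = p v" for v using h[of "-1" v] by simp
  have z0: "p 0 = 0" using h[of 0 0] by simp
  show ?thesis
  proof
    fix x y w :: 'a
    show "0 \<le> p (x - y)" using t[of "x - y" "- (x - y)"] m[of "x - y"] z0 by simp
    show "p (x - y) = p (y - x)" using m[of "x - y"] by simp
    show "p (x - y) = 0 \<longleftrightarrow> x = y" using z[of "x - y"] z0 by auto
    show "p (x - w) \<le> p (x - y) + p (y - w)" using t[of "x - y" "y - w"] by simp
  qed
qed

lemma absolute_norm_mono:
  assumes "absolute_norm N" "\<bar>a\<bar> \<le> \<bar>c\<bar>" "\<bar>b\<bar> \<le> \<bar>d\<bar>"
  shows "N (a, b) \<le> N (c, d)"
proof -
  have h: "N (r *\<^sub>R v) = \<bar>r\<bar> * N v" and t: "N (v + w) \<le> N v + N w"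
    and ab: "N (a, b) = N (\<bar>a\<bar>, \<bar>b\<bar>)" for r v w a b
    using assms(1) unfolding absolute_norm_def is_norm_def by metis+
  have fl: "N (- a, b) = N (a, b)" "N (a, - b) = N (a, b)" for a b
    using ab[of "- a" b] ab[of a "- b"] ab[of a b] by auto
  have key: "N (s * a, b) \<le> N (a, b) \<and> N (a, s * b) \<le> N (a, b)" if "0 \<le> s" "s \<le> 1" for s a b
  proof -
    have e1: "(s * a, b) = ((1 + s) / 2) *\<^sub>R (a, b) + ((1 - s) / 2) *\<^sub>R (- a, b)"
      and e2: "(a, s * b) = ((1 + s) / 2) *\<^sub>R (a, b) + ((1 - s) / 2) *\<^sub>R (a, - b)"
      by (simp_all add: field_simps)
    have "N (s * a, b) \<le> \<bar>(1 + s) / 2\<bar> * N (a, b) + \<bar>(1 - s) / 2\<bar> * N (- a, b)"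
      unfolding e1 by (rule order_trans[OF t]) (simp only: h order_refl)
    moreover have "N (a, s * b) \<le> \<bar>(1 + s) / 2\<bar> * N (a, b) + \<bar>(1 - s) / 2\<bar> * N (a, - b)"
      unfolding e2 by (rule order_trans[OF t]) (simp only: h order_refl)
    ultimately show ?thesis using that by (simp add: fl field_simps)
  qed
  have fr: "\<exists>s. 0 \<le> s \<and> s \<le> 1 \<and> \<bar>a\<bar> = s * \<bar>c\<bar>" if "\<bar>a\<bar> \<le> \<bar>c\<bar>" for a c :: real
  proof (cases "c = 0")
    case False
    then show ?thesis using that by (intro exI[of _ "\<bar>a\<bar> / \<bar>c\<bar>"]) auto
  qed (use that in \<open>auto intro: exI[of _ 0]\<close>)
  obtain s where s: "0 \<le> s" "s \<le> 1" "\<bar>a\<bar> = s * \<bar>c\<bar>" using fr assms(2) by blast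
  obtain r where r: "0 \<le> r" "r \<le> 1" "\<bar>b\<bar> = r * \<bar>d\<bar>" using fr assms(3) by blast
  have "N (a, b) = N (s * \<bar>c\<bar>, r * \<bar>d\<bar>)" using ab[of a b] s r by simp
  also have "\<dots> \<le> N (\<bar>c\<bar>, r * \<bar>d\<bar>)" using key[OF s(1,2)] by blast
  also have "\<dots> \<le> N (\<bar>c\<bar>, \<bar>d\<bar>)" using key[OF r(1,2)] by blast
  finally show ?thesis using ab[of c d] by simp
qed

lemma is_norm_sum_norm:
  assumes "absolute_norm N"
  shows "is_norm (sum_norm N :: 'a::real_normed_vector \<times> 'b::real_normed_vector \<Rightarrow> real)"
proof -
  have h: "N (r *\<^sub>R v) = \<bar>r\<bar> * N v" and t: "N (v + w) \<le> N v + N w" and z: "N v = 0 \<Longrightarrow> v = 0"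
    for r v w using assms unfolding absolute_norm_def is_norm_def by metis+
  show ?thesis unfolding is_norm_def
  proof (intro conjI allI impI)
    fix v w :: "'a \<times> 'b" and c :: real
    show "v = 0" if "sum_norm N v = 0"
      using z[of "(norm (fst v), norm (snd v))"] that
      by (auto simp: sum_norm_def prod_eq_iff split: prod.splits)
    show "sum_norm N (c *\<^sub>R v) = \<bar>c\<bar> * sum_norm N v"
      using h[of "\<bar>c\<bar>" "(norm (fst v), norm (snd v))"]
      by (simp add: sum_norm_def split_beta)
    have "sum_norm N (v + w) \<le> N ((norm (fst v), norm (snd v)) + (norm (fst w), norm (snd w)))"
      unfolding sum_norm_def split_beta plus_prod_def fst_conv snd_conv
      by (rule absolute_norm_mono[OF assms]) (auto intro: norm_triangle_ineq)
    also have "\<dots> \<le> sum_norm N v + sum_norm N w"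
      using t[of "(norm (fst v), norm (snd v))" "(norm (fst w), norm (snd w))"]
      by (simp add: sum_norm_def split_beta)
    finally show "sum_norm N (v + w) \<le> sum_norm N v + sum_norm N w" .
  qed
qed

lemma daugavet_point_norm_iff:
  fixes x :: "'a::real_normed_vector"
  shows "daugavet_point norm x \<longleftrightarrow> norm x = 1 \<and>
    (\<forall>\<epsilon>>0. cball 0 1 \<subseteq> closure (convex hull {y \<in> cball 0 1. norm (x - y) \<ge> 2 - \<epsilon>}))"
proof -
  have "norm_topology norm = (euclidean :: 'a topology)"
    unfolding norm_topology_def dist_norm[symmetric] by (rule mtopology_is_euclidean)
  moreover have "unit_ball norm = cball (0::'a) 1"
    by (auto simp: unit_ball_def)
  ultimately show ?thesis
    by (simp add: daugavet_point_def Delta_def)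
qed

end

theory Submission imports Defs begin

text \<open>
  Approximate \<open>(u, 0)\<close> with \<open>\<parallel>u\<parallel> = 1\<close> by a convex combination of points \<open>(u\<^sub>i, v\<^sub>i)\<close> of the unit
  ball that are almost at distance 2 from \<open>(x, y)\<close>; then most \<open>u\<^sub>i\<close> have norm almost 1. If
  \<open>\<parallel>x - u\<^sub>i\<parallel>\<close> were substantially smaller than \<open>\<parallel>x\<parallel> + \<parallel>u\<^sub>i\<parallel>\<close>, then \<open>N\<close> would be almost constant in
  its first argument up to \<open>(\<parallel>x\<parallel> + \<parallel>u\<^sub>i\<parallel>, \<parallel>y\<parallel> + \<parallel>v\<^sub>i\<parallel>)\<close>, forcing \<open>\<parallel>y\<parallel> + \<parallel>v\<^sub>i\<parallel>\<close> to be almost 2. Then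
  both \<open>\<parallel>u\<^sub>i\<parallel>\<close> and \<open>\<parallel>v\<^sub>i\<parallel>\<close> are almost 1, so \<open>N (1, 1) = 1\<close>, which characterises the maximum norm.
  Hence most \<open>u\<^sub>i\<close> are almost at distance 2 from \<open>x / \<parallel>x\<parallel>\<close>, and the few others may be replaced by
  \<open>- x / \<parallel>x\<parallel>\<close>.
\<close>

section \<open>Absolute normalised norms on the plane\<close>

lemma absolute_normD:
  assumes "absolute_norm N"
  shows "N (r *\<^sub>R v) = \<bar>r\<bar> * N v" and "N (v + w) \<le> N v + N w"
    and "N (a, b) = N (\<bar>a\<bar>, \<bar>b\<bar>)"
  using assms unfolding absolute_norm_def is_norm_def by metis+

lemma normalised_axes:
  assumes "absolute_norm N" "normalised N"
  shows "N (a, 0) = \<bar>a\<bar>" and "N (0, b) = \<bar>b\<bar>"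
  using absolute_normD(1)[OF assms(1), of a "(1, 0)"] absolute_normD(1)[OF assms(1), of b "(0, 1)"]
    assms(2) by (auto simp: normalised_def)

lemma normalised_ge_abs:
  assumes "absolute_norm N" "normalised N"
  shows "\<bar>a\<bar> \<le> N (a, b)" and "\<bar>b\<bar> \<le> N (a, b)"
  using absolute_norm_mono[OF assms(1), of a a 0 b] absolute_norm_mono[OF assms(1), of 0 a b b]
  by (auto simp: normalised_axes[OF assms])

lemma linf_norm_if_one_one:
  assumes "absolute_norm N" "normalised N" "N (1, 1) \<le> 1"
  shows "N = linf_norm"
proof (intro ext, clarify)
  fix a b :: real
  define m where "m = max \<bar>a\<bar> \<bar>b\<bar>"
  have "N (a, b) \<le> N (m, m)"
    by (rule absolute_norm_mono[OF assms(1)]) (auto simp: m_def)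
  also have "\<dots> = m * N (1, 1)"
    using absolute_normD(1)[OF assms(1), of m "(1, 1)"] by (auto simp: m_def)
  also have "\<dots> \<le> m"
    using assms(3) mult_left_mono[of "N (1, 1)" 1 m] by (auto simp: m_def)
  finally show "N (a, b) = linf_norm (a, b)"
    using normalised_ge_abs[OF assms(1,2), where a = a and b = b]
    by (auto simp: linf_norm_def m_def)
qed

text \<open>In the use below, \<open>(a, b)\<close> and \<open>(c, d)\<close> hold the coordinate
  norms of the given point and of a point far from it, and \<open>e\<close> is the distance of their
  first coordinates. What matters is that \<delta> depends only on \<open>N\<close> and
  \<eta>.\<close>

lemma almost_additive_first_coordinate:
  assumes N: "absolute_norm N" "normalised N" "1 < N (1, 1)"
    and "0 < \<eta>" "\<eta> \<le> 1"
  obtains \<delta> where "0 < \<delta>" "\<delta> \<le> \<eta>"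
    and "\<And>a b c d e. \<lbrakk>0 \<le> a; 0 \<le> b; 0 \<le> c; 0 \<le> d; 0 \<le> e; N (a, b) \<le> 1; N (c, d) \<le> 1;
           1 - \<delta> \<le> c; 2 - \<delta> \<le> N (e, b + d)\<rbrakk> \<Longrightarrow> a + c - \<eta> < e"
proof -
  \<comment> \<open>The point \<open>(1 - s, 1 - s)\<close> has \<open>N\<close>-norm 1, so
    \<open>(1 - s / 2, 1 - s / 2)\<close> lies outside the unit ball of \<open>N\<close>; the
    contradiction comes from \<open>(c, d)\<close> dominating it.\<close>
  define s where "s = 1 - 1 / N (1, 1)"
  define \<delta> where "\<delta> = \<eta> * s / 4"
  have s: "0 < s" "s < 1" using N(3) by (auto simp: s_def)
  have "\<delta> < \<eta>" and "0 < \<delta>" and \<delta>s: "\<delta> \<le> s / 2"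
    using s \<open>0 < \<eta>\<close> \<open>\<eta> \<le> 1\<close> mult_strict_left_mono[of s 1 \<eta>] mult_right_mono[of \<eta> 1 s]
    by (auto simp: \<delta>_def)
  moreover have "a + c - \<eta> < e"
    if nn: "0 \<le> a" "0 \<le> b" "0 \<le> c" "0 \<le> d" "0 \<le> e" and ab: "N (a, b) \<le> 1" and cd: "N (c, d) \<le> 1"
      and c: "1 - \<delta> \<le> c" and far: "2 - \<delta> \<le> N (e, b + d)" for a b c d e
  proof (rule ccontr)
    assume "\<not> a + c - \<eta> < e"
    then have e: "e \<le> a + c - \<eta>" by simp
    have le1: "a \<le> 1" "b \<le> 1" "c \<le> 1" "d \<le> 1"
      using normalised_ge_abs[OF N(1,2), where a = a and b = b]
        normalised_ge_abs[OF N(1,2), where a = c and b = d] ab cd by auto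
    define \<theta> where "\<theta> = \<eta> / 2"
    have \<theta>: "0 < \<theta>" "\<theta> < 1" using \<open>0 < \<eta>\<close> \<open>\<eta> \<le> 1\<close> by (auto simp: \<theta>_def)
    \<comment> \<open>Since \<open>a + c \<le> 2\<close>, the additive loss \<eta> is at least the
      proportional loss \<open>\<theta> * (a + c)\<close>, which suits convexity.\<close>
    have "\<theta> * (a + c) \<le> \<theta> * 2" using \<theta> le1 by (intro mult_left_mono) auto
    also have "\<theta> * 2 = \<eta>" by (simp add: \<theta>_def)
    finally have "e \<le> (a + c) - \<theta> * (a + c)"
      using e diff_left_mono order_trans by blast
    then have "e \<le> (1 - \<theta>) * (a + c)" by (simp add: left_diff_distrib)
    then have "N (e, b + d) \<le> N ((1 - \<theta>) * (a + c), b + d)"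
      using nn \<theta> by (intro absolute_norm_mono[OF N(1)]) auto
    also have "\<dots> = N (\<theta> *\<^sub>R (0, b + d) + (1 - \<theta>) *\<^sub>R (a + c, b + d))"
      by (simp add: algebra_simps)
    also have "\<dots> \<le> \<theta> * N (0, b + d) + (1 - \<theta>) * N (a + c, b + d)"
      using absolute_normD(2)[OF N(1), of "\<theta> *\<^sub>R (0, b + d)" "(1 - \<theta>) *\<^sub>R (a + c, b + d)"]
        absolute_normD(1)[OF N(1), of \<theta> "(0, b + d)"]
        absolute_normD(1)[OF N(1), of "1 - \<theta>" "(a + c, b + d)"] \<theta> by auto
    also have "\<dots> \<le> \<theta> * (b + d) + (1 - \<theta>) * 2"
      using absolute_normD(2)[OF N(1), of "(a, b)" "(c, d)"] ab cd \<theta> nn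
      by (intro add_mono mult_left_mono) (auto simp: normalised_axes[OF N(1,2)])
    also have "\<dots> = 2 - \<theta> * (2 - (b + d))" by (simp add: algebra_simps)
    finally have "\<theta> * (2 - (b + d)) \<le> \<delta>" using far by simp
    also have "\<delta> = \<theta> * (s / 2)" by (simp add: \<delta>_def \<theta>_def)
    finally have "2 - (b + d) \<le> s / 2" using \<theta>(1) by (simp only: mult_le_cancel_left_pos)
    then have "1 - s / 2 \<le> d" using le1 by simp
    moreover have "1 - s / 2 \<le> c" using c \<delta>s by simp
    ultimately have "N (1 - s / 2, 1 - s / 2) \<le> N (c, d)"
      using s by (intro absolute_norm_mono[OF N(1)]) auto
    then have "(1 - s / 2) * N (1, 1) \<le> 1"
      using absolute_normD(1)[OF N(1), of "1 - s / 2" "(1, 1)"] s cd by auto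
    moreover have "(1 - s / 2) * N (1, 1) = (N (1, 1) + 1) / 2"
      using N(3) by (simp add: s_def field_simps)
    ultimately show False using N(3) by simp
  qed
  ultimately show thesis using that by force
qed

section \<open>Daugavet-points and coordinate maps\<close>

text \<open>Every point of the ball lies on a segment between two antipodal unit vectors, and the
  closed hull is convex.\<close>

lemma daugavet_pointI_sphere:
  fixes x :: "'a::real_normed_vector"
  assumes "norm x = 1"
    and sph: "\<And>\<epsilon> u. \<lbrakk>0 < \<epsilon>; norm u = 1\<rbrakk> \<Longrightarrow>
      u \<in> closure (convex hull {y \<in> cball 0 1. norm (x - y) \<ge> 2 - \<epsilon>})"
  shows "daugavet_point norm x"
  unfolding daugavet_point_norm_iff
proof (intro conjI allI impI subsetI)
  fix \<epsilon> :: real and u :: 'a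
  assume "0 < \<epsilon>" and u: "u \<in> cball 0 1"
  let ?C = "closure (convex hull {y \<in> cball 0 1. norm (x - y) \<ge> 2 - \<epsilon>})"
  define w where "w = (if u = 0 then x else u /\<^sub>R norm u)"
  have w: "norm w = 1" "u = norm u *\<^sub>R w" using assms(1) by (auto simp: w_def)
  have "w \<in> ?C" "- w \<in> ?C" using sph \<open>0 < \<epsilon>\<close> w(1) by auto
  then have "((1 + norm u) / 2) *\<^sub>R w + ((1 - norm u) / 2) *\<^sub>R (- w) \<in> ?C"
    using u by (intro convexD convex_closure convex_convex_hull) (auto simp: field_simps)
  also have "((1 + norm u) / 2) *\<^sub>R w + ((1 - norm u) / 2) *\<^sub>R (- w) = norm u *\<^sub>R w"
    by (simp flip: scaleR_left_diff_distrib add: diff_divide_distrib add_divide_distrib)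
  finally show "u \<in> ?C" using w(2) by simp
qed (rule assms(1))

text \<open>Divide the hypothesis by \<open>norm x\<close>. Replacing the rescaled \<open>u\<close>
  by \<open>u\<close> costs at most \<open>(1 / norm x - 1) * norm u\<close>, exactly the surplus
  gained by the division.\<close>

lemma norm_diff_normalized_ge:
  fixes x u :: "'a::real_normed_vector"
  assumes "x \<noteq> 0" "norm x \<le> 1" "norm x + norm u - \<eta> \<le> norm (x - u)"
  shows "1 + norm u - \<eta> / norm x \<le> norm (x /\<^sub>R norm x - u)"
proof -
  define a where "a = norm x"
  have a: "0 < a" "a \<le> 1" using assms by (auto simp: a_def)
  have "(x - u) /\<^sub>R a = (x /\<^sub>R a - u) + (1 - 1 / a) *\<^sub>R u"
    by (simp add: algebra_simps divide_inverse)
  then have "norm (x - u) / a \<le> norm (x /\<^sub>R a - u) + \<bar>1 - 1 / a\<bar> * norm u"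
    using norm_triangle_ineq[of "x /\<^sub>R a - u" "(1 - 1 / a) *\<^sub>R u"] a
    by (metis abs_of_pos divide_inverse_commute norm_scaleR positive_imp_inverse_positive)
  moreover have "\<bar>1 - 1 / a\<bar> = 1 / a - 1" using a by auto
  moreover have "(a + norm u - \<eta>) / a \<le> norm (x - u) / a"
    using assms(3) a by (intro divide_right_mono) (auto simp: a_def)
  moreover have "(a + norm u - \<eta>) / a = 1 + norm u / a - \<eta> / a"
    using a by (simp add: add_divide_distrib diff_divide_distrib)
  ultimately show ?thesis
    unfolding a_def[symmetric] by (simp add: left_diff_distrib)
qed

text \<open>The distance to a convex set is convex and the right side is concave in
  \<open>w\<close>, so the bound survives convex combinations. This avoids counting the exceptional
  points of a combination.\<close>

lemma convex_hull_distance_bound: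
  fixes P :: "'c::real_vector \<Rightarrow> 'a::real_normed_vector"
  assumes "linear P" "convex C" "0 \<le> L"
    and "\<And>w. w \<in> D \<Longrightarrow> \<exists>p \<in> C. norm (P w - p) \<le> L * (1 - norm (P w))"
    and "w \<in> convex hull D"
  shows "\<exists>p \<in> C. norm (P w - p) \<le> L * (1 - norm (P w))"
proof -
  let ?K = "{w. \<exists>p \<in> C. norm (P w - p) \<le> L * (1 - norm (P w))}"
  have "convex ?K"
  proof (rule convexI, clarify)
    fix v w p q and s t :: real
    assume st: "0 \<le> s" "0 \<le> t" "s + t = 1" and pq: "p \<in> C" "q \<in> C"
      and v: "norm (P v - p) \<le> L * (1 - norm (P v))"
      and w: "norm (P w - q) \<le> L * (1 - norm (P w))"
    let ?z = "s *\<^sub>R v + t *\<^sub>R w"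
    have Pz: "P ?z = s *\<^sub>R P v + t *\<^sub>R P w"
      using assms(1) by (simp add: linear_add linear_scale)
    have "norm (P ?z - (s *\<^sub>R p + t *\<^sub>R q)) = norm (s *\<^sub>R (P v - p) + t *\<^sub>R (P w - q))"
      by (simp add: Pz algebra_simps)
    also have "\<dots> \<le> s * norm (P v - p) + t * norm (P w - q)"
      using st norm_triangle_ineq[of "s *\<^sub>R (P v - p)" "t *\<^sub>R (P w - q)"] by simp
    also have "\<dots> \<le> s * (L * (1 - norm (P v))) + t * (L * (1 - norm (P w)))"
      using st v w by (intro add_mono mult_left_mono) auto
    also have "\<dots> = L * ((s + t) - (s * norm (P v) + t * norm (P w)))"
      by (simp add: algebra_simps)
    also have "\<dots> \<le> L * (1 - norm (P ?z))"
      using st assms(3) norm_triangle_ineq[of "s *\<^sub>R P v" "t *\<^sub>R P w"]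
      by (intro mult_left_mono) (auto simp: Pz)
    finally show "\<exists>r \<in> C. norm (P ?z - r) \<le> L * (1 - norm (P ?z))"
      using convexD[OF assms(2) pq st] by blast
  qed
  then show ?thesis using hull_minimal[of D ?K convex] assms(4,5) by blast
qed

text \<open>
  Describing the sum by its coordinate maps \<open>P\<close>, \<open>Q\<close> and an embedding \<open>J\<close> lets the same lemma
  serve both summands.
\<close>

lemma daugavet_point_coordinate:
  fixes P :: "'c::real_vector \<Rightarrow> 'a::real_normed_vector" and Q :: "'c \<Rightarrow> 'b::real_normed_vector"
  assumes N: "absolute_norm N" "normalised N" "1 < N (1, 1)"
    and p: "is_norm p" "\<And>w. p w = N (norm (P w), norm (Q w))"
    and lin: "linear P" "linear Q"
    and J: "\<And>u. P (J u) = u" "\<And>u. Q (J u) = 0"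
    and z: "daugavet_point p z" and nz: "P z \<noteq> 0"
  shows "daugavet_point norm (P z /\<^sub>R norm (P z))"
proof (rule daugavet_pointI_sphere)
  define a where "a = norm (P z)"
  have pz: "N (a, norm (Q z)) = 1"
    using z p(2) by (auto simp: daugavet_point_def a_def)
  then have a: "0 < a" "a \<le> 1"
    using normalised_ge_abs(1)[OF N(1,2), of a "norm (Q z)"] nz by (auto simp: a_def)
  show "norm (P z /\<^sub>R norm (P z)) = 1" using nz by simp
  fix \<epsilon> :: real and u :: 'a
  assume \<epsilon>: "0 < \<epsilon>" and u: "norm u = 1"
  let ?x = "P z /\<^sub>R norm (P z)"
  let ?C = "convex hull {y \<in> cball 0 1. norm (?x - y) \<ge> 2 - \<epsilon>}"
  define \<eta> where "\<eta> = min 1 (a * \<epsilon> / 2)"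
  have \<eta>: "0 < \<eta>" "\<eta> \<le> 1" "\<eta> / a \<le> \<epsilon> / 2" using a \<epsilon> by (auto simp: \<eta>_def min_def field_simps)
  obtain \<delta> where \<delta>: "0 < \<delta>" "\<delta> \<le> \<eta>"
    and rot: "\<And>a b c d e. \<lbrakk>0 \<le> a; 0 \<le> b; 0 \<le> c; 0 \<le> d; 0 \<le> e; N (a, b) \<le> 1; N (c, d) \<le> 1;
           1 - \<delta> \<le> c; 2 - \<delta> \<le> N (e, b + d)\<rbrakk> \<Longrightarrow> a + c - \<eta> < e"
    using almost_additive_first_coordinate[OF N \<eta>(1,2)] by blast
  have "\<eta> \<le> \<eta> / a" using a \<eta> by (simp add: field_simps)
  have Delta: "\<exists>q \<in> ?C. norm (P w - q) \<le> 2 / \<delta> * (1 - norm (P w))" if "w \<in> Delta p \<delta> z" for w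
  proof -
    have w: "N (norm (P w), norm (Q w)) \<le> 1"
      and far: "2 - \<delta> \<le> N (norm (P z - P w), norm (Q z - Q w))"
      using that lin by (auto simp: Delta_def unit_ball_def p(2) linear_diff)
    have Pw: "norm (P w) \<le> 1"
      using normalised_ge_abs(1)[OF N(1,2), of "norm (P w)" "norm (Q w)"] w by simp
    show ?thesis
    proof (cases "1 - \<delta> \<le> norm (P w)")
      case True
      have "N (norm (P z - P w), norm (Q z - Q w)) \<le> N (norm (P z - P w), norm (Q z) + norm (Q w))"
        using norm_triangle_ineq4[of "Q z" "Q w"] by (intro absolute_norm_mono[OF N(1)]) auto
      then have "a + norm (P w) - \<eta> < norm (P z - P w)"
        using True w far pz a by (intro rot[of a "norm (Q z)" _ "norm (Q w)"]) auto
      then have "1 + norm (P w) - \<eta> / a \<le> norm (?x - P w)"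
        using norm_diff_normalized_ge[OF nz, of "P w" \<eta>] a by (simp add: a_def)
      \<comment> \<open>The total loss is at most \<open>\<delta> + \<eta> / a\<close>, hence at
        most \<open>2 * (\<eta> / a) \<le> \<epsilon>\<close>.\<close>
      then have "2 - \<epsilon> \<le> norm (?x - P w)"
        using True \<delta> \<eta> \<open>\<eta> \<le> \<eta> / a\<close> by linarith
      then have "P w \<in> ?C" using Pw by (intro hull_inc) auto
      then show ?thesis using Pw \<delta> by (intro bexI[of _ "P w"]) auto
    next
      case False
      \<comment> \<open>An exceptional point is replaced by \<open>- ?x\<close>. The error is at
        most 2, and the norm deficit above \<delta> pays for it.\<close>
      have nx: "norm ?x = 1" using nz by simp
      have "norm (?x - - ?x) = 2 * norm ?x"
        using norm_scaleR[of 2 ?x] unfolding scaleR_2 by simp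
      then have "- ?x \<in> ?C"
        using \<epsilon> nx by (intro hull_inc CollectI conjI) (simp_all add: nz)
      moreover have "norm (P w - - ?x) \<le> 2"
        using norm_triangle_ineq[of "P w" ?x] Pw nx by simp
      moreover have "2 \<le> 2 / \<delta> * (1 - norm (P w))" using False \<delta> by (simp add: field_simps)
      ultimately show ?thesis by (intro bexI[of _ "- ?x"]) auto
    qed
  qed
  show "u \<in> closure ?C"
    unfolding closure_approachable
  proof (intro allI impI)
    fix e :: real
    assume "0 < e"
    \<comment> \<open>As \<open>norm u = 1\<close>, an approximation within \<tau> has norm deficit
      at most \<tau>, so passing on to \<open>q\<close> costs at most
      \<open>2 / \<delta> * \<tau>\<close> more.\<close>
    define \<tau> where "\<tau> = e / (1 + 2 / \<delta>)"
    have "0 < 1 + 2 / \<delta>" using \<delta> by (simp add: add_pos_pos)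
    then have "0 < \<tau>" and "(1 + 2 / \<delta>) * \<tau> = e" using \<open>0 < e\<close> by (simp_all add: \<tau>_def)
    then have \<tau>: "0 < \<tau>" "\<tau> + 2 / \<delta> * \<tau> = e" by (simp_all add: distrib_right)
    have "J u \<in> unit_ball p" using normalised_axes[OF N(1,2)] u by (simp add: unit_ball_def p(2) J)
    then have "J u \<in> norm_topology p closure_of (convex hull Delta p \<delta> z)"
      using z \<delta> unfolding daugavet_point_def by blast
    then obtain w where hw: "w \<in> convex hull Delta p \<delta> z" and "p (J u - w) < \<tau>"
      using \<tau>(1) unfolding norm_topology_def
        Metric_space.metric_closure_of[OF Metric_space_is_norm[OF p(1)]]
        Metric_space.in_mball[OF Metric_space_is_norm[OF p(1)]] by blast
    then have uw: "norm (u - P w) < \<tau>"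
      using normalised_ge_abs(1)[OF N(1,2), of "norm (u - P w)" "norm (Q (J u - w))"] lin
      by (simp add: p(2) linear_diff J)
    obtain q where q: "q \<in> ?C" "norm (P w - q) \<le> 2 / \<delta> * (1 - norm (P w))"
      using convex_hull_distance_bound[OF lin(1) convex_convex_hull _ Delta hw] \<delta> by auto
    have "1 - norm (P w) \<le> \<tau>" using norm_triangle_sub[of u "P w"] u uw by simp
    then have "2 / \<delta> * (1 - norm (P w)) \<le> 2 / \<delta> * \<tau>" using \<delta> by (intro mult_left_mono) auto
    then have "norm (u - q) < e"
      using norm_triangle_ineq[of "u - P w" "P w - q"] q(2) uw \<tau>(2) by simp
    then show "\<exists>y \<in> ?C. dist y u < e" using q(1) by (auto simp: dist_norm norm_minus_commute)
  qed
qed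

text \<open>Exchanging the arguments of \<open>N\<close> lets the coordinate lemma treat the second
  summand as the first.\<close>

lemma absolute_norm_swap:
  assumes "absolute_norm N"
  shows "absolute_norm (\<lambda>v. N (prod.swap v))"
  unfolding absolute_norm_def is_norm_def
proof (intro conjI allI impI)
  fix c a b :: real and v w :: "real \<times> real"
  note N = absolute_normD[OF assms]
  show "v = 0" if "N (prod.swap v) = 0"
    using that assms unfolding absolute_norm_def is_norm_def
    by (metis swap_swap swap_simp zero_prod_def)
  show "N (prod.swap (c *\<^sub>R v)) = \<bar>c\<bar> * N (prod.swap v)"
    using N(1)[of c "prod.swap v"] by (cases v) simp
  show "N (prod.swap (v + w)) \<le> N (prod.swap v) + N (prod.swap w)"
    using N(2)[of "prod.swap v" "prod.swap w"] by (cases v; cases w) simp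
  show "N (prod.swap (a, b)) = N (prod.swap (\<bar>a\<bar>, \<bar>b\<bar>))"
    using N(3)[of b a] by simp
qed

theorem theorem3p1:
  fixes x :: "'a::banach" and y :: "'b::banach"
    and N :: "real \<times> real \<Rightarrow> real"
  assumes "x \<in> unit_ball norm" and "y \<in> unit_ball norm"
    and "absolute_norm N" and "normalised N" and "N \<noteq> linf_norm"
    and "daugavet_point (sum_norm N) (x, y)"
  shows "(x \<noteq> 0 \<longrightarrow> daugavet_point norm (x /\<^sub>R norm x)) \<and>
         (y \<noteq> 0 \<longrightarrow> daugavet_point norm (y /\<^sub>R norm y))"
proof (intro conjI impI)
  note N = assms(3,4)
  have N11: "1 < N (1, 1)" using linf_norm_if_one_one[OF N] assms(5) by force
  have p: "is_norm (sum_norm N :: 'a \<times> 'b \<Rightarrow> real)" by (rule is_norm_sum_norm[OF N(1)])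
  show "daugavet_point norm (x /\<^sub>R norm x)" if "x \<noteq> 0"
    using daugavet_point_coordinate[OF N N11 p, of fst snd "\<lambda>u. (u, 0)" "(x, y)"] assms(6) that
    by (auto simp: sum_norm_def split_beta linear_fst linear_snd)
  have N': "normalised (\<lambda>v. N (prod.swap v))" using N(2) by (simp add: normalised_def)
  show "daugavet_point norm (y /\<^sub>R norm y)" if "y \<noteq> 0"
    using daugavet_point_coordinate[OF absolute_norm_swap[OF N(1)] N' _ p,
        of snd fst "\<lambda>u. (0, u)" "(x, y)"] N11 assms(6) that
    by (auto simp: sum_norm_def split_beta linear_fst linear_snd)
qed

end
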